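(* The Oppermann conjecture implies the strong Legendre conjecture, which in turn implies the standard Legendre conjecture. That is: (a) Suppose that for every integer $m\ge 2$ there is at least one prime in each of the open intervals $\left(m(m-1),m^2\right)$ and $\left(m^2,m(m+1)\right)$. Then for every integer $m\ge 1$ there are at least two primes in the open interval $\left(m^2,(m+1)^2\right)$. (b) If for every integer $m\ge 1$ there are at least two primes in $\left(m^2,(m+1)^2\right)$, then for every integer $m\ge 1$ there is at least one prime in $\left(m^2,(m+1)^2\right)$.
   Context: The Oppermann conjecture is the hypothesis of (a). The strong Legendre conjecture asserts that for every integer $m\ge1$ the open interval $(m^2,(m+1)^2)$ contains at least two primes; the standard Legendre conjecture asserts that for every integer $m\ge 1$ it contains at least one prime. *)

theory Defs
  imports Complex_Main "HOL-Computational_Algebra.Primes"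
begin

(* All quantities are of type int, so that m - 1 does not truncate; prime on int
   holds of positive primes only. *)

definition oppermann_conjecture :: bool where
  "oppermann_conjecture \<longleftrightarrow>
     (\<forall>m::int. m \<ge> 2 \<longrightarrow>
        (\<exists>p \<in> {m * (m - 1) <..< m^2}. prime p) \<and>
        (\<exists>p \<in> {m^2 <..< m * (m + 1)}. prime p))"

definition strong_legendre_conjecture :: bool where
  "strong_legendre_conjecture \<longleftrightarrow>
     (\<forall>m::int. m \<ge> 1 \<longrightarrow> card {p \<in> {m^2 <..< (m + 1)^2}. prime p} \<ge> 2)"

definition legendre_conjecture :: bool where
  "legendre_conjecture \<longleftrightarrow>
     (\<forall>m::int. m \<ge> 1 \<longrightarrow> (\<exists>p \<in> {m^2 <..< (m + 1)^2}. prime p))"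

end

theory Submission
  imports Defs
begin

text \<open>
  The number \<open>m * (m + 1)\<close> splits the interval from \<open>m\<^sup>2\<close> to \<open>(m + 1)\<^sup>2\<close> into two halves. The left
  half is the upper Oppermann interval of \<open>m\<close>; the right half is the lower Oppermann interval of
  \<open>m + 1\<close>. Oppermann's hypothesis, used at two consecutive integers, therefore puts one prime on
  each side of the splitting point. This covers \<open>m \<ge> 2\<close>. For \<open>m = 1\<close> the left half, from 1 to 2,
  contains no integer, but the primes 2 and 3 both lie between 1 and 4.
  The second implication holds because a set with at least two elements is nonempty.
\<close>

lemma card_ge_2I:
  assumes "finite A" "x \<in> A" "y \<in> A" "x \<noteq> y"
  shows "2 \<le> card A"
  using card_mono[of A "{x, y}"] assms by simp

lemma oppermann_imp_strong_legendre:
  assumes oppermann_conjecture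
  shows strong_legendre_conjecture
  unfolding strong_legendre_conjecture_def
proof (intro allI impI)
  fix m :: int
  assume m: "m \<ge> 1"
  let ?P = "{p \<in> {m^2 <..< (m + 1)^2}. prime p}"
  have "\<exists>p q. p \<in> ?P \<and> q \<in> ?P \<and> p \<noteq> q"
  proof (cases "m = 1")
    case True
    have "prime (2::int)" "prime (3::int)"
      by simp_all
    with True have "2 \<in> ?P" "3 \<in> ?P"
      by auto
    moreover have "(2::int) \<noteq> 3"
      by simp
    ultimately show ?thesis
      by blast
  next
    case False
    with m have "m \<ge> 2" "m + 1 \<ge> 2"
      by simp_all
    with assms obtain p q where
      p: "prime p" "m^2 < p" "p < m * (m + 1)" and
      q: "prime q" "(m + 1) * (m + 1 - 1) < q" "q < (m + 1)^2"
      unfolding oppermann_conjecture_def by (meson greaterThanLessThan_iff)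
    have "m^2 < m * (m + 1)" "m * (m + 1) < (m + 1)^2"
      using m by (simp_all add: power2_eq_square algebra_simps)
    moreover have "m * (m + 1) < q"
      using q(2) by (simp add: mult.commute)
    ultimately have "p \<in> ?P" "q \<in> ?P" "p \<noteq> q"
      using p q by auto
    then show ?thesis
      by blast
  qed
  moreover have "finite ?P"
    by (rule finite_subset[of _ "{m^2 <..< (m + 1)^2}"]) auto
  ultimately show "2 \<le> card ?P"
    by (meson card_ge_2I)
qed

lemma strong_legendre_imp_legendre:
  assumes strong_legendre_conjecture
  shows legendre_conjecture
  unfolding legendre_conjecture_def
proof (intro allI impI)
  fix m :: int
  assume "m \<ge> 1"
  with assms have "2 \<le> card {p \<in> {m^2 <..< (m + 1)^2}. prime p}"
    unfolding strong_legendre_conjecture_def by blast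
  then have "{p \<in> {m^2 <..< (m + 1)^2}. prime p} \<noteq> {}"
    by (metis card.empty not_numeral_le_zero)
  then show "\<exists>p \<in> {m^2 <..< (m + 1)^2}. prime p"
    by blast
qed

theorem mainTheorem2:
  shows "(oppermann_conjecture \<longrightarrow> strong_legendre_conjecture) \<and>
         (strong_legendre_conjecture \<longrightarrow> legendre_conjecture)"
  using oppermann_imp_strong_legendre strong_legendre_imp_legendre by blast

end
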